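(* Let $M$ and $N$ be positive integers with $d = \gcd(M + 1, N + 1)$, $M + 1 = dM'$, and $N + 1 = dN'$. Then the size of a kernel subset of either the even or the odd vertices of the $M \times N$ grid is always of the form $uvM'N'$ with $u + v = d$, for some nonnegative integers $u$ and $v$. Furthermore, when it is a kernel subset of the odd vertices of the grid and $d$ is even, both of $u$ and $v$ must be even as well (that is, the size is of the form $uvM'N'$ with $u + v = d$ and $u$, $v$ both even nonnegative integers). Conversely, every number which satisfies these conditions does occur as the size of some such subset: for all nonnegative integers $u$, $v$ with $u + v = d$ there is a kernel subset of the even vertices of size $uvM'N'$; and for all nonnegative integers $u$, $v$ with $u + v = d$, both even in case $d$ is even, there is a kernel subset of the odd vertices of size $uvM'N'$.
   Context: The $M \times N$ grid is the graph whose vertices are the integer points $(x, y)$ with $1 \le x \le M$ and $1 \le y \le N$, two vertices being adjacent when they are at distance $1$. A vertex $(x, y)$ is even or odd according to the parity of $x + y$. A kernel subset of the even (respectively, odd) vertices of the grid is a set $V$ of even (respectively, odd) vertices such that every vertex of the grid has an even number of neighbours in $V$. *)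

theory Defs
  imports "HOL-Analysis.Analysis"
begin

definition grid :: "nat \<Rightarrow> nat \<Rightarrow> (int \<times> int) set" where
  "grid M N = {1..int M} \<times> {1..int N}"

(* Euclidean distance in the plane, via the metric on real \<times> real. *)
definition adjacent :: "int \<times> int \<Rightarrow> int \<times> int \<Rightarrow> bool" where
  "adjacent p q \<longleftrightarrow>
     dist (real_of_int (fst p), real_of_int (snd p)) (real_of_int (fst q), real_of_int (snd q)) = 1"

definition even_vertices :: "nat \<Rightarrow> nat \<Rightarrow> (int \<times> int) set" where
  "even_vertices M N = {p \<in> grid M N. even (fst p + snd p)}"

definition odd_vertices :: "nat \<Rightarrow> nat \<Rightarrow> (int \<times> int) set" where
  "odd_vertices M N = {p \<in> grid M N. odd (fst p + snd p)}"

(* W is the colour class (even_vertices M N or odd_vertices M N). The parity condition ranges over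
   all vertices of the grid, not only those in W. *)
definition kernel_subset ::
    "nat \<Rightarrow> nat \<Rightarrow> (int \<times> int) set \<Rightarrow> (int \<times> int) set \<Rightarrow> bool" where
  "kernel_subset M N W V \<longleftrightarrow>
     V \<subseteq> W \<and> (\<forall>p \<in> grid M N. even (card {q \<in> V. adjacent p q}))"

lemma adjacent_iff: "adjacent (x, y) (x', y') \<longleftrightarrow> \<bar>x - x'\<bar> + \<bar>y - y'\<bar> = 1"
proof -
  have "adjacent (x, y) (x', y') \<longleftrightarrow>
      (real_of_int x - real_of_int x')\<^sup>2 + (real_of_int y - real_of_int y')\<^sup>2 = 1"
    by (simp add: adjacent_def dist_Pair_Pair dist_real_def)
  also have "\<dots> \<longleftrightarrow> real_of_int ((x - x')\<^sup>2 + (y - y')\<^sup>2) = real_of_int 1"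
    by simp
  also have "\<dots> \<longleftrightarrow> (x - x')\<^sup>2 + (y - y')\<^sup>2 = 1"
    by (simp only: of_int_eq_iff)
  also have "\<dots> \<longleftrightarrow> \<bar>x - x'\<bar> + \<bar>y - y'\<bar> = 1"
  proof -
    have *: "a\<^sup>2 + b\<^sup>2 = 1 \<longleftrightarrow> \<bar>a\<bar> + \<bar>b\<bar> = 1" for a b :: int
    proof
      assume h: "a\<^sup>2 + b\<^sup>2 = 1"
      have le: "\<bar>c\<bar> \<le> c\<^sup>2" for c :: int
        using self_le_power[of "\<bar>c\<bar>" 2] by (cases "c = 0") auto
      have "\<bar>a\<bar> + \<bar>b\<bar> \<le> 1" using le[of a] le[of b] h by linarith
      moreover have "\<not> (a = 0 \<and> b = 0)" using h by auto
      ultimately show "\<bar>a\<bar> + \<bar>b\<bar> = 1" by arith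
    next
      assume "\<bar>a\<bar> + \<bar>b\<bar> = 1"
      then have "(a = 0 \<and> \<bar>b\<bar> = 1) \<or> (\<bar>a\<bar> = 1 \<and> b = 0)" by arith
      then show "a\<^sup>2 + b\<^sup>2 = 1"
        by (metis add_0 add.right_neutral power2_abs one_power2 zero_power2)
    qed
    show ?thesis by (rule *)
  qed
  finally show ?thesis .
qed

end

theory Submission
  imports Defs
begin

text \<open>
  Reflecting a kernel subset in the lines \<open>x = k (M + 1)\<close> and \<open>y = k (N + 1)\<close> gives a solution
  on the whole lattice of the discrete wave equation over the field with two elements, and
  vanishing on the axes forces it to be \<open>F (x, y) = G (x + y) + G (x - y)\<close> with \<open>G\<close> even. Vanishing
  on the other two families of lines makes \<open>G\<close> periodic modulo \<open>2 (M + 1)\<close> and \<open>2 (N + 1)\<close>, hence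
  modulo \<open>2 d\<close>. The torus of size \<open>2 (M + 1) \<times> 2 (N + 1)\<close> contains four copies of the subset and is
  tiled by \<open>M' N'\<close> tori of size \<open>2 d \<times> 2 d\<close>; in each of these, \<open>(x + y, x - y)\<close> covers twice every
  pair of residues modulo \<open>2 d\<close> of the relevant parity. So the subset has \<open>u v M' N'\<close> elements,
  where \<open>u\<close> and \<open>v\<close> count the residues of that parity on which \<open>G\<close> is true and false. Negation acts on
  these residues without fixed points exactly when they are odd and \<open>d\<close> is even.
\<close>

section \<open>Reflection and periodicity\<close>

text \<open>The distance from \<open>x\<close> to the nearest multiple of \<open>2 * m\<close>: it
  folds the line onto \<open>0..m\<close>, with mirrors at the multiples of
  \<open>m\<close>.\<close>

definition tent :: "int \<Rightarrow> int \<Rightarrow> int" where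
  "tent m x = min (x mod (2 * m)) (2 * m - x mod (2 * m))"

lemma tent_bounds:
  assumes "m > 0"
  shows "0 \<le> tent m x" "tent m x \<le> m"
  using pos_mod_bound[of "2 * m" x] pos_mod_sign[of "2 * m" x] assms
  unfolding tent_def by linarith+

lemma tent_id:
  assumes "m > 0" "0 \<le> x" "x \<le> m"
  shows "tent m x = x"
  using assms by (simp add: tent_def)

lemma tent_add_period: "tent m (x + 2 * m * k) = tent m x"
  by (simp add: tent_def)

lemma tent_minus: "m > 0 \<Longrightarrow> tent m (- x) = tent m x"
  by (auto simp: tent_def zmod_zminus1_eq_if)

lemma tent_decompose:
  assumes "m > 0"
  obtains k where "x = tent m x + 2 * m * k" | k where "x = - tent m x + 2 * m * k"
proof (cases "x mod (2 * m) \<le> m")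
  case True
  then have "x = tent m x + 2 * m * (x div (2 * m))"
    using mod_mult_div_eq[of x "2 * m"] by (simp add: tent_def)
  then show ?thesis using that by blast
next
  case False
  then have "x = - tent m x + 2 * m * (x div (2 * m) + 1)"
    using mod_mult_div_eq[of x "2 * m"] by (simp add: tent_def algebra_simps)
  then show ?thesis using that by blast
qed

text \<open>Away from the mirrors the fold is a local isometry that may reverse direction. The
  parity condition is symmetric in the two neighbours, so either outcome serves.\<close>

lemma tent_neighbours_interior:
  assumes "m > 0" "0 < tent m x" "tent m x < m"
  shows "tent m (x + 1) = tent m x + 1 \<and> tent m (x - 1) = tent m x - 1 \<or>
         tent m (x + 1) = tent m x - 1 \<and> tent m (x - 1) = tent m x + 1"
proof -
  define r where "r = tent m x"
  have up: "tent m (r + 1) = r + 1" and down: "tent m (r - 1) = r - 1"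
    using assms by (auto simp: r_def intro!: tent_id)
  from \<open>m > 0\<close> show ?thesis unfolding r_def[symmetric]
  proof (cases rule: tent_decompose[of m x])
    case (1 k)
    then have "x + 1 = (r + 1) + 2 * m * k" "x - 1 = (r - 1) + 2 * m * k"
      by (auto simp: r_def)
    then show "tent m (x + 1) = r + 1 \<and> tent m (x - 1) = r - 1 \<or>
      tent m (x + 1) = r - 1 \<and> tent m (x - 1) = r + 1"
      by (simp only: tent_add_period up down) simp
  next
    case (2 k)
    then have "x + 1 = - (r - 1) + 2 * m * k" "x - 1 = - (r + 1) + 2 * m * k"
      by (auto simp: r_def)
    then show "tent m (x + 1) = r + 1 \<and> tent m (x - 1) = r - 1 \<or>
      tent m (x + 1) = r - 1 \<and> tent m (x - 1) = r + 1"
      using \<open>m > 0\<close> by (simp only: tent_add_period tent_minus up down) simp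
  qed
qed

text \<open>Here \<open>x\<close> is a multiple of \<open>m\<close>, so the reflection in
  \<open>x\<close> preserves \<open>tent m\<close> and exchanges the two neighbours.\<close>

lemma tent_neighbours_boundary:
  assumes "m > 0" "tent m x = 0 \<or> tent m x = m"
  shows "tent m (x + 1) = tent m (x - 1)"
proof -
  have "\<exists>k. x = m * k"
  proof (rule tent_decompose[OF assms(1), of x])
    fix k assume "x = tent m x + 2 * m * k"
    with assms(2) have "x = m * (2 * k) \<or> x = m * (1 + 2 * k)"
      by (auto simp: algebra_simps)
    then show ?thesis by blast
  next
    fix k assume "x = - tent m x + 2 * m * k"
    with assms(2) have "x = m * (2 * k) \<or> x = m * (2 * k - 1)"
      by (auto simp: algebra_simps)
    then show ?thesis by blast
  qed
  then obtain k where k: "x = m * k" ..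
  then have "x + 1 = - (x - 1) + 2 * m * k" by simp
  then show ?thesis using assms(1) by (metis tent_add_period tent_minus)
qed

lemma periodic_int_mult:
  fixes f :: "int \<Rightarrow> 'a"
  assumes "\<And>x. f (x + c) = f x"
  shows "f (x + c * k) = f x"
proof -
  interpret periodic_fun_simple f c by unfold_locales (rule assms)
  show ?thesis using plus_of_int[of x k] by (simp add: mult.commute)
qed

lemma periodic_gcd:
  fixes f :: "int \<Rightarrow> 'a"
  assumes "\<And>x. f (x + a) = f x" "\<And>x. f (x + b) = f x"
  shows "f (x + gcd a b) = f x"
proof -
  obtain i j where "i * a + j * b = gcd a b" using bezout_int by blast
  then have "f (x + gcd a b) = f ((x + a * i) + b * j)" by (simp add: algebra_simps)
  also have "\<dots> = f x" by (simp only: periodic_int_mult[of f a, OF assms(1)] periodic_int_mult[of f b, OF assms(2)])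
  finally show ?thesis .
qed

section \<open>Kernel subsets and solutions of the discrete wave equation\<close>

text \<open>The colour is a number \<open>p\<close>, 0 for even and 1 for odd, so that both cases
  share one argument.\<close>

definition colour_class :: "nat \<Rightarrow> nat \<Rightarrow> int \<Rightarrow> (int \<times> int) set" where
  "colour_class M N p = {q \<in> grid M N. even (fst q + snd q + p)}"

lemma colour_class_0: "colour_class M N 0 = even_vertices M N"
  by (auto simp: colour_class_def even_vertices_def)

lemma colour_class_1: "colour_class M N 1 = odd_vertices M N"
  by (auto simp: colour_class_def odd_vertices_def)

text \<open>d'Alembert's form of a solution over the field with two elements, where
  \<open>\<noteq>\<close> is addition. Only arguments of \<open>G\<close> with the parity of
  \<open>p\<close> matter.\<close>

definition wave_set :: "nat \<Rightarrow> nat \<Rightarrow> int \<Rightarrow> (int \<Rightarrow> bool) \<Rightarrow> (int \<times> int) set" where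
  "wave_set M N p G =
     {(x, y). (x, y) \<in> grid M N \<and> even (x + y + p) \<and> G (x + y) \<noteq> G (x - y)}"

text \<open>Nested equivalences say that four truth values sum to zero modulo 2; pairing them
  horizontally and vertically turns the kernel condition into the wave equation.\<close>

lemma even_card_neighbours_iff:
  "even (card {q \<in> V. adjacent (x, y) q}) \<longleftrightarrow>
     (((x + 1, y) \<in> V) = ((x - 1, y) \<in> V)) = (((x, y + 1) \<in> V) = ((x, y - 1) \<in> V))"
proof -
  have "{q \<in> V. adjacent (x, y) q} =
      V \<inter> {(x + 1, y), (x - 1, y), (x, y + 1), (x, y - 1)}"
  proof (rule set_eqI, clarify)
    fix a b
    have "\<bar>x - a\<bar> + \<bar>y - b\<bar> = 1 \<longleftrightarrow>
        a = x + 1 \<and> b = y \<or> a = x - 1 \<and> b = y \<or> a = x \<and> b = y + 1 \<or> a = x \<and> b = y - 1"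
      by arith
    then show "(a, b) \<in> {q \<in> V. adjacent (x, y) q} \<longleftrightarrow>
        (a, b) \<in> V \<inter> {(x + 1, y), (x - 1, y), (x, y + 1), (x, y - 1)}"
      by (auto simp: adjacent_iff)
  qed
  then show ?thesis by (simp add: Int_insert_right)
qed

text \<open>Evenness and the two periods make \<open>F\<close> vanish on the four lines framing the
  grid, so neighbours outside the grid rightly count as non-members.\<close>

lemma kernel_subset_wave_set:
  fixes G :: "int \<Rightarrow> bool"
  assumes even: "\<And>a. G (- a) = G a"
    and pM: "\<And>a. G (a + 2 * (int M + 1)) = G a"
    and pN: "\<And>a. G (a + 2 * (int N + 1)) = G a"
  shows "kernel_subset M N (colour_class M N p) (wave_set M N p G)"
proof -
  define F where "F x y \<longleftrightarrow> even (x + y + p) \<and> G (x + y) \<noteq> G (x - y)" for x y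
  have x0: "\<not> F 0 y" for y using even[of y] by (simp add: F_def)
  have y0: "\<not> F x 0" for x by (simp add: F_def)
  have xM: "\<not> F (int M + 1) y" for y
    using even[of "int M + 1 - y"] pM[of "y - int M - 1"] by (simp add: F_def algebra_simps)
  have yN: "\<not> F x (int N + 1)" for x
    using pN[of "x - int N - 1"] by (simp add: F_def algebra_simps)
  have V: "(x, y) \<in> wave_set M N p G \<longleftrightarrow> F x y"
    if "0 \<le> x" "x \<le> int M + 1" "0 \<le> y" "y \<le> int N + 1" for x y
  proof (cases "x = 0 \<or> y = 0 \<or> x = int M + 1 \<or> y = int N + 1")
    case True
    then show ?thesis using x0 y0 xM yN by (auto simp: wave_set_def grid_def)
  next
    case False
    then show ?thesis using that by (auto simp: wave_set_def grid_def F_def)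
  qed
  have wave: "(F (x + 1) y = F (x - 1) y) = (F x (y + 1) = F x (y - 1))" for x y
  proof (cases "even (x + y + p + 1)")
    case True
    \<comment> \<open>Each of the values of \<open>G\<close> at \<open>x + y + 1\<close>,
      \<open>x + y - 1\<close>, \<open>x - y + 1\<close> and \<open>x - y - 1\<close> occurs twice
      and cancels.\<close>
    then show ?thesis by (auto simp: F_def algebra_simps)
  next
    case False
    then show ?thesis by (auto simp: F_def)
  qed
  show ?thesis
    unfolding kernel_subset_def
  proof (intro conjI ballI)
    show "wave_set M N p G \<subseteq> colour_class M N p"
      by (auto simp: wave_set_def colour_class_def)
    fix q assume q: "q \<in> grid M N"
    obtain x y where xy: "q = (x, y)" by (cases q)
    have "1 \<le> x" "x \<le> int M" "1 \<le> y" "y \<le> int N"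
      using q by (auto simp: xy grid_def)
    then show "even (card {q' \<in> wave_set M N p G. adjacent q q'})"
      unfolding xy even_card_neighbours_iff using wave[of x y] by (simp add: V)
  qed
qed

text \<open>
  \<open>h\<close> is the column \<open>x = 1\<close> of the solution, and the recursion solves
  \<open>h y = G (y + 1) + G (y - 1)\<close> for \<open>G\<close>.
\<close>
fun wave_profile :: "(nat \<Rightarrow> bool) \<Rightarrow> nat \<Rightarrow> bool" where
  "wave_profile h 0 = False"
| "wave_profile h (Suc 0) = False"
| "wave_profile h (Suc (Suc k)) = (h (Suc k) \<noteq> wave_profile h k)"

text \<open>The equation advances column by column, so columns 0 and 1 determine the solution for
  nonnegative \<open>x\<close>. An even \<open>G\<close> matches the zero column 0, and
  \<open>G\<close> is built to match column 1.\<close>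

lemma wave_equation_solution:
  fixes F :: "int \<Rightarrow> int \<Rightarrow> bool"
  assumes wave: "\<And>x y. (F (x + 1) y = F (x - 1) y) = (F x (y + 1) = F x (y - 1))"
    and x0: "\<And>y. \<not> F 0 y" and y0: "\<And>x. \<not> F x 0"
    and refl: "\<And>y. F 1 (- y) = F 1 y"
  obtains G :: "int \<Rightarrow> bool"
  where "\<And>a. G (- a) = G a" "\<And>x y. 0 \<le> x \<Longrightarrow> F x y = (G (x + y) \<noteq> G (x - y))"
proof -
  \<comment> \<open>The two initial values False are a choice: \<open>F\<close> determines
    \<open>G\<close> only up to a constant on each parity class.\<close>
  define g where "g = wave_profile (\<lambda>k. F 1 (int k))"
  define G where "G a = g (nat \<bar>a\<bar>)" for a
  have even: "G (- a) = G a" for a by (simp add: G_def)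
  have pos: "F 1 y = (G (y + 1) \<noteq> G (y - 1))" if "0 < y" for y
  proof -
    obtain k where "y = int (Suc k)" using \<open>0 < y\<close> by (metis gr0_conv_Suc zero_less_imp_eq_int)
    then have "nat \<bar>y + 1\<bar> = Suc (Suc k)" "nat \<bar>y - 1\<bar> = k" "y = int (Suc k)" by auto
    then show ?thesis by (auto simp: G_def g_def)
  qed
  have col1: "F 1 y = (G (1 + y) \<noteq> G (1 - y))" for y
  proof -
    consider "0 < y" | "y = 0" | "0 < - y" by linarith
    then show ?thesis
    proof cases
      case 1 then show ?thesis using pos[of y] even[of "1 - y"] by (simp add: add.commute)
    next
      case 2 then show ?thesis using y0 by simp
    next
      case 3
      have "- y + 1 = 1 - y" "- y - 1 = - (1 + y)" by simp_all
      with 3 show ?thesis using pos[of "- y"] even[of "1 + y"] refl[of y] by metis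
    qed
  qed
  have "\<forall>y. F (int k) y = (G (int k + y) \<noteq> G (int k - y))" for k
  proof (induction k rule: induct_nat_012)
    case 0
    then show ?case using x0 even by simp
  next
    case 1
    then show ?case using col1 by simp
  next
    case (ge2 k)
    show ?case
    proof
      fix y
      have "F (int k + 2) y = F (int k) y \<longleftrightarrow> F (int k + 1) (y + 1) = F (int k + 1) (y - 1)"
        using wave[of "int k + 1" y] by (simp add: algebra_simps)
      moreover have "F (int k) y = (G (int k + y) \<noteq> G (int k - y))"
        using ge2 by blast
      moreover have "F (int k + 1) (y + 1) = (G (int k + 2 + y) \<noteq> G (int k - y))"
        using ge2(2)[rule_format, of "y + 1"] by (simp add: algebra_simps)
      moreover have "F (int k + 1) (y - 1) = (G (int k + y) \<noteq> G (int k + 2 - y))"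
        using ge2(2)[rule_format, of "y - 1"] by (simp add: algebra_simps)
      ultimately show "F (int (Suc (Suc k))) y =
          (G (int (Suc (Suc k)) + y) \<noteq> G (int (Suc (Suc k)) - y))"
        by (simp add: algebra_simps) blast
    qed
  qed
  then have "F x y = (G (x + y) \<noteq> G (x - y))" if "0 \<le> x" for x y
    using that by (metis zero_le_imp_eq_int)
  with even show ?thesis using that by blast
qed

lemma kernel_subset_is_wave_set:
  assumes "M > 0" "N > 0" and ker: "kernel_subset M N (colour_class M N p) V"
  obtains G :: "int \<Rightarrow> bool"
  where "\<And>a. G (- a) = G a" "\<And>a. G (a + 2 * int (gcd (M + 1) (N + 1))) = G a"
    "V = wave_set M N p G"
proof -
  define m n where "m = int M + 1" and "n = int N + 1"
  have mn: "m > 1" "n > 1" "m > 0" "n > 0" using assms by (auto simp: m_def n_def)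
  \<comment> \<open>Extension by reflection; modulo 2 the sign changes of an odd reflection
    disappear.\<close>
  define F where "F x y \<longleftrightarrow> (tent m x, tent n y) \<in> V" for x y
  have sub: "1 \<le> x" "x < m" "1 \<le> y" "y < n" "even (x + y + p)" if "(x, y) \<in> V" for x y
    using ker that by (auto simp: kernel_subset_def colour_class_def grid_def m_def n_def)
  have bnd_x: "\<not> F x y" if "tent m x = 0 \<or> tent m x = m" for x y
    using that sub[of "tent m x" "tent n y"] by (auto simp: F_def)
  have bnd_y: "\<not> F x y" if "tent n y = 0 \<or> tent n y = n" for x y
    using that sub[of "tent m x" "tent n y"] by (auto simp: F_def)
  \<comment> \<open>On a mirror, the neighbours along it are zero and those across it agree;
    elsewhere this is the kernel condition at the folded vertex.\<close>
  have wave: "(F (x + 1) y = F (x - 1) y) = (F x (y + 1) = F x (y - 1))" for x y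
  proof (cases "tent m x = 0 \<or> tent m x = m")
    case True
    then show ?thesis using tent_neighbours_boundary[OF mn(3) True] bnd_x[OF True]
      by (simp add: F_def)
  next
    case x: False
    show ?thesis
    proof (cases "tent n y = 0 \<or> tent n y = n")
      case True
      then show ?thesis using tent_neighbours_boundary[OF mn(4) True] bnd_y[OF True]
        by (simp add: F_def)
    next
      case y: False
      have tx: "0 < tent m x" "tent m x < m" and ty: "0 < tent n y" "tent n y < n"
        using x y tent_bounds[OF mn(3), of x] tent_bounds[OF mn(4), of y] by auto
      have "even (card {q \<in> V. adjacent (tent m x, tent n y) q})"
        using ker tx ty by (auto simp: kernel_subset_def grid_def m_def n_def)
      then show ?thesis
        unfolding even_card_neighbours_iff F_def
        using tent_neighbours_interior[OF mn(3) tx] tent_neighbours_interior[OF mn(4) ty]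
        by auto
    qed
  qed
  obtain G :: "int \<Rightarrow> bool" where even: "\<And>a. G (- a) = G a"
    and G: "\<And>x y. 0 \<le> x \<Longrightarrow> F x y = (G (x + y) \<noteq> G (x - y))"
  proof (rule wave_equation_solution[of F])
    show "(F (x + 1) y = F (x - 1) y) = (F x (y + 1) = F x (y - 1))" for x y by (rule wave)
    show "\<not> F 0 y" for y by (rule bnd_x) (use mn in \<open>simp add: tent_id\<close>)
    show "\<not> F x 0" for x by (rule bnd_y) (use mn in \<open>simp add: tent_id\<close>)
    show "F 1 (- y) = F 1 y" for y using mn by (simp add: F_def tent_minus)
  qed (rule that)
  \<comment> \<open>At \<open>(m, a + m)\<close> the arguments of \<open>G\<close> are
    \<open>a + 2 * m\<close> and \<open>- a\<close>.\<close>
  have pm: "G (a + 2 * m) = G a" for a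
  proof -
    have "\<not> F m (a + m)" by (rule bnd_x) (use mn in \<open>simp add: tent_id\<close>)
    then show ?thesis using G[of m "a + m"] even[of a] mn by (simp add: algebra_simps)
  qed
  \<comment> \<open>The formula for \<open>F\<close> covers only \<open>0 \<le> x\<close>; evenness
    of \<open>G\<close> supplies the remaining arguments afterwards.\<close>
  have pn0: "G (x + n) = G (x - n)" if "0 \<le> x" for x
  proof -
    have "\<not> F x n" by (rule bnd_y) (use mn in \<open>simp add: tent_id\<close>)
    then show ?thesis using G[of x n] that by simp
  qed
  have pn: "G (a + 2 * n) = G a" for a
  proof (cases "0 \<le> a + n")
    case True
    then show ?thesis using pn0[of "a + n"] by (simp add: algebra_simps)
  next
    case False
    then show ?thesis using pn0[of "- (a + n)"] even[of a] even[of "a + 2 * n"]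
      by (simp add: algebra_simps)
  qed
  have "gcd (2 * m) (2 * n) = 2 * int (gcd (M + 1) (N + 1))"
    using gcd_mult_distrib_int[of 2 m n] by (simp add: m_def n_def add.commute flip: gcd_int_int_eq)
  then have per: "G (a + 2 * int (gcd (M + 1) (N + 1))) = G a" for a
    using periodic_gcd[of G "2 * m" "2 * n" a, OF pm pn] by simp
  have "(x, y) \<in> V \<longleftrightarrow> (x, y) \<in> wave_set M N p G" for x y
  proof (cases "(x, y) \<in> grid M N")
    case True
    then have "F x y \<longleftrightarrow> (x, y) \<in> V" "0 \<le> x"
      by (auto simp: F_def tent_id m_def n_def grid_def)
    then show ?thesis using True G[of x y] sub(5)[of x y] by (auto simp: wave_set_def)
  next
    case False
    then show ?thesis using ker
      by (auto simp: wave_set_def kernel_subset_def colour_class_def)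
  qed
  then have "V = wave_set M N p G" by auto
  with even per show ?thesis using that by blast
qed

section \<open>Counting on the torus\<close>

lemma sum_periodic_shift:
  fixes f :: "int \<Rightarrow> 'a :: comm_monoid_add"
  assumes "\<And>x. f (x + n) = f x" "n > 0"
  shows "(\<Sum>x\<in>{0..<n}. f (x + c)) = sum f {0..<n}"
proof (rule sum.reindex_bij_witness[where i = "\<lambda>y. (y - c) mod n" and j = "\<lambda>x. (x + c) mod n"])
  fix x assume "x \<in> {0..<n}"
  have "f ((x + c) mod n + n * ((x + c) div n)) = f ((x + c) mod n)"
    by (rule periodic_int_mult) (rule assms)
  then show "f ((x + c) mod n) = f (x + c)" by simp
qed (use assms in \<open>auto simp: mod_simps\<close>)

lemma sum_periodic_mult:
  fixes f :: "int \<Rightarrow> nat"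
  assumes "\<And>x. f (x + n) = f x" "n > 0"
  shows "sum f {0..<n * int k} = k * sum f {0..<n}"
proof (induction k)
  case (Suc k)
  have "{0..<n * int (Suc k)} = {0..<n * int k} \<union> {n * int k..<n * int k + n}"
    using \<open>n > 0\<close> by (subst ivl_disj_un_two(3)) (auto simp: distrib_left)
  moreover have "sum f {n * int k..<n * int k + n} = (\<Sum>x\<in>{0..<n}. f (x + n * int k))"
    by (rule sum.reindex_bij_witness[where i = "\<lambda>x. x + n * int k" and j = "\<lambda>x. x - n * int k"]) auto
  moreover have "\<dots> = sum f {0..<n}"
    by (rule sum_periodic_shift) (use assms in auto)
  moreover have "sum f ({0..<n * int k} \<union> {n * int k..<n * int k + n}) =
      sum f {0..<n * int k} + sum f {n * int k..<n * int k + n}"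
    by (rule sum.union_disjoint) auto
  ultimately show ?case using Suc by simp
qed simp

lemma sum_reflect:
  fixes f :: "int \<Rightarrow> nat"
  assumes "\<And>x. f (2 * m - x) = f x" "f 0 = 0" "f m = 0" "m > 0"
  shows "sum f {0..<2 * m} = 2 * sum f {1..<m}"
proof -
  have "{0..<2 * m} = {0, m} \<union> ({1..<m} \<union> {m + 1..<2 * m})"
    using \<open>m > 0\<close> by auto
  moreover have "sum f \<dots> = sum f {0, m} + (sum f {1..<m} + sum f {m + 1..<2 * m})"
    using \<open>m > 0\<close> by (subst sum.union_disjoint, simp, simp, fastforce)+ simp
  moreover have "sum f {m + 1..<2 * m} = sum f {1..<m}"
    by (rule sum.reindex_bij_witness[where i = "\<lambda>x. 2 * m - x" and j = "\<lambda>x. 2 * m - x"])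
      (use assms in auto)
  ultimately show ?thesis using assms by simp
qed

lemma sum_parity_class:
  fixes f :: "int \<Rightarrow> nat"
  assumes "p \<in> {0, 1}"
  shows "(\<Sum>a\<in>{0..<2 * d}. if even (a + p) then f a else 0) = (\<Sum>i\<in>{0..<d}. f (2 * i + p))"
proof -
  have "(\<Sum>a\<in>{0..<2 * d}. if even (a + p) then f a else 0) =
      sum f {a \<in> {0..<2 * d}. even (a + p)}"
    by (rule sum.inter_filter[symmetric]) simp
  also have "\<dots> = (\<Sum>i\<in>{0..<d}. f (2 * i + p))"
    by (rule sum.reindex_bij_witness[where i = "\<lambda>i. 2 * i + p" and j = "\<lambda>a. a div 2"])
      (use assms in auto)
  finally show ?thesis .
qed

lemma sum_unequal_pairs:
  assumes "finite A"
  shows "(\<Sum>i\<in>A. \<Sum>j\<in>A. of_bool (K i \<noteq> K j)) = 2 * card {i \<in> A. K i} * card {i \<in> A. \<not> K i}"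
proof -
  have inner: "(\<Sum>j\<in>A. of_bool (K i \<noteq> K j)) =
      (if K i then card {j \<in> A. \<not> K j} else card {j \<in> A. K j})" for i
    using assms by (auto simp: of_bool_def sum.If_cases Int_def)
  show ?thesis
    using assms unfolding inner by (simp add: sum.If_cases Int_def)
qed

text \<open>The sum of \<open>F\<close> over the large torus is evaluated twice: folding gives four
  times the cardinality, and tiling gives \<open>M' * N'\<close> times the sum over a small torus,
  which is four times the product of the two counts.\<close>

lemma card_wave_set:
  fixes G :: "int \<Rightarrow> bool"
  assumes even: "\<And>a. G (- a) = G a" and per: "\<And>a. G (a + 2 * int d) = G a"
    and M: "M + 1 = d * M'" and N: "N + 1 = d * N'" and p: "p \<in> {0, 1}"
  shows "card (wave_set M N p G) =
    card {i \<in> {0..<int d}. G (2 * i + p)} * card {i \<in> {0..<int d}. \<not> G (2 * i + p)} * M' * N'"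
proof -
  define D where "D = int d"
  have D: "D > 0" using M by (cases d) (auto simp: D_def)
  have m: "int M + 1 = D * int M'" and n: "int N + 1 = D * int N'"
    using arg_cong[OF M, of int] arg_cong[OF N, of int] by (simp_all add: D_def)
  have perD: "G (a + 2 * D * k) = G a" for a k
    by (rule periodic_int_mult) (use per in \<open>simp add: D_def\<close>)
  have pm: "G (a + 2 * (int M + 1)) = G a" for a
    using perD[of a "int M'"] by (simp add: m mult.assoc)
  have pn: "G (a + 2 * (int N + 1)) = G a" for a
    using perD[of a "int N'"] by (simp add: n mult.assoc)
  define F :: "int \<Rightarrow> int \<Rightarrow> nat"
    where "F x y = of_bool (even (x + y + p) \<and> G (x + y) \<noteq> G (x - y))" for x y
  have Fx0: "F 0 y = 0" for y using even[of y] by (simp add: F_def)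
  have Fy0: "F x 0 = 0" for x by (simp add: F_def)
  have Fper_y: "F x (y + 2 * D) = F x y" for x y
    using perD[of "x + y" 1] perD[of "x - y" "- 1"] by (simp add: F_def algebra_simps)
  have Fper_x: "F (x + 2 * D) y = F x y" for x y
    using perD[of "x + y" 1] perD[of "x - y" 1] by (simp add: F_def algebra_simps)
  have Frefl_x: "F (- x) y = F x y" for x y
    using even[of "x - y"] even[of "x + y"] by (auto simp: F_def algebra_simps)
  have Frefl_y: "F x (- y) = F x y" for x y
    by (auto simp: F_def algebra_simps)
  have FxM: "F (int M + 1) y = 0" for y
    using even[of "int M + 1 - y"] pm[of "y - int M - 1"] by (simp add: F_def algebra_simps)
  have FyN: "F x (int N + 1) = 0" for x
    using pn[of "x - int N - 1"] by (simp add: F_def algebra_simps)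
  have Fmul_x: "F (x + 2 * D * k) y = F x y" for x y k
    by (rule periodic_int_mult[of "\<lambda>x. F x y"]) (rule Fper_x)
  have Fmul_y: "F x (y + 2 * D * k) = F x y" for x y k
    by (rule periodic_int_mult[of "F x"]) (rule Fper_y)

  have fourfold: "(\<Sum>x\<in>{0..<2 * (int M + 1)}. \<Sum>y\<in>{0..<2 * (int N + 1)}. F x y) =
      4 * card (wave_set M N p G)"
  proof -
    have inner: "(\<Sum>y\<in>{0..<2 * (int N + 1)}. F x y) = 2 * (\<Sum>y\<in>{1..<int N + 1}. F x y)" for x
    proof (rule sum_reflect)
      show "F x (2 * (int N + 1) - y) = F x y" for y
      proof -
        have "2 * (int N + 1) - y = - y + 2 * D * int N'" by (simp add: n)
        then show ?thesis by (simp only: Fmul_y Frefl_y)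
      qed
    qed (use Fy0 FyN in auto)
    have outer: "(\<Sum>x\<in>{0..<2 * (int M + 1)}. \<Sum>y\<in>{1..<int N + 1}. F x y) =
        2 * (\<Sum>x\<in>{1..<int M + 1}. \<Sum>y\<in>{1..<int N + 1}. F x y)"
    proof (rule sum_reflect)
      show "(\<Sum>y\<in>{1..<int N + 1}. F (2 * (int M + 1) - x) y) = (\<Sum>y\<in>{1..<int N + 1}. F x y)" for x
      proof (rule sum.cong)
        show "F (2 * (int M + 1) - x) y = F x y" for y
        proof -
          have "2 * (int M + 1) - x = - x + 2 * D * int M'" by (simp add: m)
          then show ?thesis by (simp only: Fmul_x Frefl_x)
        qed
      qed simp
    qed (use Fx0 FxM in auto)
    have "card (wave_set M N p G) = (\<Sum>(x, y)\<in>grid M N. F x y)"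
    proof -
      have "wave_set M N p G =
          {(x, y). even (x + y + p) \<and> G (x + y) \<noteq> G (x - y)} \<inter> grid M N"
        by (auto simp: wave_set_def)
      moreover have "finite (grid M N)" by (simp add: grid_def)
      ultimately show ?thesis
        by (simp add: F_def case_prod_unfold sum_of_bool_eq Int_def conj_commute)
    qed
    also have "\<dots> = (\<Sum>x\<in>{1..<int M + 1}. \<Sum>y\<in>{1..<int N + 1}. F x y)"
      unfolding grid_def by (subst sum.cartesian_product[symmetric])
        (simp add: atLeastLessThanPlusOne_atLeastAtMost_int)
    finally show ?thesis
      unfolding inner sum_distrib_left[symmetric] outer by simp
  qed

  have "(\<Sum>x\<in>{0..<2 * (int M + 1)}. \<Sum>y\<in>{0..<2 * (int N + 1)}. F x y) =
      M' * N' * (\<Sum>x\<in>{0..<2 * D}. \<Sum>y\<in>{0..<2 * D}. F x y)"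
  proof -
    have "(\<Sum>y\<in>{0..<2 * D * int N'}. F x y) = N' * (\<Sum>y\<in>{0..<2 * D}. F x y)" for x
      by (rule sum_periodic_mult) (use Fper_y D in auto)
    moreover have "(\<Sum>x\<in>{0..<2 * D * int M'}. \<Sum>y\<in>{0..<2 * D}. F x y) =
        M' * (\<Sum>x\<in>{0..<2 * D}. \<Sum>y\<in>{0..<2 * D}. F x y)"
      by (rule sum_periodic_mult) (use Fper_x D in auto)
    ultimately show ?thesis
      by (simp add: m n mult.assoc flip: sum_distrib_left)
  qed
  \<comment> \<open>Put \<open>y = a - x\<close>, a shift for fixed \<open>x\<close>. Then
    \<open>x + y = a\<close> and \<open>x - y = 2 * x - a\<close>, so the parity test depends on
    \<open>a\<close> alone.\<close>
  also have "(\<Sum>x\<in>{0..<2 * D}. \<Sum>y\<in>{0..<2 * D}. F x y) =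
      (\<Sum>x\<in>{0..<2 * D}. \<Sum>a\<in>{0..<2 * D}. F x (a + - x))"
    by (intro sum.cong refl sum_periodic_shift[symmetric]) (use Fper_y D in auto)
  also have "\<dots> = (\<Sum>a\<in>{0..<2 * D}. \<Sum>x\<in>{0..<2 * D}. F x (a + - x))"
    by (rule sum.swap)
  also have "\<dots> = (\<Sum>a\<in>{0..<2 * D}. if even (a + p)
      then (\<Sum>x\<in>{0..<2 * D}. of_bool (G a \<noteq> G (2 * x - a))) else 0)"
    by (intro sum.cong) (auto simp: F_def)
  also have "\<dots> = (\<Sum>i\<in>{0..<D}. \<Sum>x\<in>{0..<2 * D}. of_bool (G (2 * i + p) \<noteq> G (2 * x - (2 * i + p))))"
    using p by (rule sum_parity_class)
  also have "\<dots> = (\<Sum>i\<in>{0..<D}. 2 * (\<Sum>j\<in>{0..<D}. of_bool (G (2 * i + p) \<noteq> G (2 * j + p))))"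
  proof (rule sum.cong)
    fix i
    define f :: "int \<Rightarrow> nat" where "f j = of_bool (G (2 * i + p) \<noteq> G (2 * j + p))" for j
    have f: "f (j + D) = f j" for j
      using perD[of "2 * j + p" 1] by (simp add: f_def algebra_simps)
    then have f2: "f (j + 2 * D) = f j" for j
      using f[of j] f[of "j + D"] by (simp add: algebra_simps)
    \<comment> \<open>Since \<open>2 * x - (2 * i + p) = 2 * (x - i - p) + p\<close>, this is a
      shifted sum of \<open>f\<close>, whose period \<open>D\<close> is covered twice.\<close>
    have "(\<Sum>x\<in>{0..<2 * D}. of_bool (G (2 * i + p) \<noteq> G (2 * x - (2 * i + p)))) =
        (\<Sum>x\<in>{0..<2 * D}. f (x + (- i - p)))"
      by (simp add: f_def algebra_simps)
    also have "\<dots> = sum f {0..<2 * D}"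
      by (rule sum_periodic_shift) (use f2 D in auto)
    also have "\<dots> = 2 * sum f {0..<D}"
      using sum_periodic_mult[of f D 2] f D by (simp add: mult.commute)
    finally show "(\<Sum>x\<in>{0..<2 * D}. of_bool (G (2 * i + p) \<noteq> G (2 * x - (2 * i + p)))) =
        2 * (\<Sum>j\<in>{0..<D}. of_bool (G (2 * i + p) \<noteq> G (2 * j + p)) :: nat)"
      unfolding f_def .
  qed simp
  \<comment> \<open>The second factor 2 arises because unequal pairs are counted in both
    orders.\<close>
  also have "\<dots> = 4 * card {i \<in> {0..<D}. G (2 * i + p)} * card {i \<in> {0..<D}. \<not> G (2 * i + p)}"
    by (subst sum_distrib_left[symmetric], subst sum_unequal_pairs) simp_all
  finally have "4 * card (wave_set M N p G) = M' * N' *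
      (4 * card {i \<in> {0..<D}. G (2 * i + p)} * card {i \<in> {0..<D}. \<not> G (2 * i + p)})"
    unfolding fourfold .
  also have "\<dots> = 4 * (card {i \<in> {0..<D}. G (2 * i + p)} * card {i \<in> {0..<D}. \<not> G (2 * i + p)} * M' * N')"
    by (simp only: mult_ac)
  finally show ?thesis unfolding D_def[symmetric] by (simp only: mult_cancel1) simp
qed

lemma card_split:
  assumes "finite A"
  shows "card {i \<in> A. P i} + card {i \<in> A. \<not> P i} = card A"
proof -
  have "{i \<in> A. P i} = A \<inter> Collect P" "{i \<in> A. \<not> P i} = A - Collect P" by auto
  then show ?thesis using card_Int_Diff[OF assms, of "Collect P"] by simp
qed

section \<open>The attainable values\<close>

text \<open>Negating \<open>2 * i + 1\<close> modulo \<open>2 * d\<close> sends \<open>i\<close> to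
  \<open>d - 1 - i\<close>. For even \<open>d\<close> no index is fixed, so the true residues come
  in pairs, each with one member in the lower half.\<close>

lemma even_card_odd_profile:
  fixes G :: "int \<Rightarrow> bool"
  assumes even: "\<And>a. G (- a) = G a" and per: "\<And>a. G (a + 2 * int d) = G a" and "even d"
  shows "even (card {i \<in> {0..<int d}. G (2 * i + 1)})"
proof -
  obtain e where e: "d = 2 * e" using \<open>even d\<close> by (elim evenE)
  define A where "A = {i \<in> {0..<int e}. G (2 * i + 1)}"
  have G: "G (2 * (int d - 1 - i) + 1) = G (2 * i + 1)" for i
    using even[of "2 * i + 1"] per[of "- (2 * i + 1)"] by (simp add: algebra_simps)
  have split: "{i \<in> {0..<int d}. G (2 * i + 1)} = A \<union> (\<lambda>i. int d - 1 - i) ` A"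
  proof (rule set_eqI)
    fix i
    have "i \<in> (\<lambda>i. int d - 1 - i) ` A \<longleftrightarrow> int d - 1 - i \<in> A"
      by (auto simp: image_iff intro!: bexI[of _ "int d - 1 - i"])
    then show "i \<in> {i \<in> {0..<int d}. G (2 * i + 1)} \<longleftrightarrow> i \<in> A \<union> (\<lambda>i. int d - 1 - i) ` A"
      using G[of i] by (auto simp: A_def e)
  qed
  have "finite A"
    unfolding A_def by (rule finite_subset[of _ "{0..<int e}"]) auto
  then have "card (A \<union> (\<lambda>i. int d - 1 - i) ` A) = card A + card ((\<lambda>i. int d - 1 - i) ` A)"
    by (intro card_Un_disjoint) (auto simp: A_def e)
  also have "card ((\<lambda>i. int d - 1 - i) ` A) = card A"
    by (rule card_image) (auto simp: inj_on_def)
  finally show ?thesis unfolding split by simp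
qed

text \<open>
  The case \<open>u = d\<close>, \<open>p = 0\<close>, \<open>d\<close> even is left out because the profile used here switches off the
  residue \<open>0\<close> whenever \<open>u\<close> is even; exchanging \<open>u\<close> and \<open>v\<close> covers it.
\<close>
lemma exists_profile:
  assumes "d > 0" "u \<le> d"
    and p: "p = 0 \<and> (odd u \<or> u < d) \<or> p = 1 \<and> even u"
  obtains G :: "int \<Rightarrow> bool" where "\<And>a. G (- a) = G a" "\<And>a. G (a + 2 * int d) = G a"
    "card {i \<in> {0..<int d}. G (2 * i + p)} = u"
proof -
  define t where "t = int (u div 2)"
  \<comment> \<open>On the circle of residues modulo \<open>2 * d\<close>, \<open>tent\<close> is
    the distance from 0, so \<open>G\<close> is an arc of radius \<open>u\<close> about 0. Residue
    0, its own negative, is kept only for odd \<open>u\<close>, to correct the parity of the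
    count.\<close>
  define G where "G a \<longleftrightarrow> tent (int d) a \<le> int u \<and> (tent (int d) a = 0 \<longrightarrow> odd u)" for a
  have tent: "tent (int d) (2 * i + p) = min (2 * i + p) (2 * int d - (2 * i + p))"
    if "i \<in> {0..<int d}" for i
    using that p by (auto simp: tent_def)
  \<comment> \<open>Indices from \<open>lo\<close> up to but excluding \<open>hi\<close> give the
    nonnegative side of the arc, the last \<open>t\<close> indices the negative side;
    \<open>lo\<close> is 1 when residue 0 is switched off.\<close>
  define lo where "lo = (if p = 0 \<and> even u then 1 else 0 :: int)"
  define hi where "hi = (if p = 0 then t + 1 else t)"
  have u: "int u = 2 * t + (if even u then 0 else 1)"
    by (auto simp: t_def elim!: evenE oddE)
  have t: "0 \<le> t" "2 * t \<le> int d" using u assms(2) by (auto simp: t_def)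
  then have bounds: "0 \<le> lo" "hi \<le> int d" "t \<le> int d"
    using assms(1) by (auto simp: lo_def hi_def)
  have "{i \<in> {0..<int d}. G (2 * i + p)} = {lo..<hi} \<union> {int d - t..<int d}"
  proof (rule set_eqI)
    fix i
    show "i \<in> {i \<in> {0..<int d}. G (2 * i + p)} \<longleftrightarrow> i \<in> {lo..<hi} \<union> {int d - t..<int d}"
    proof (cases "i \<in> {0..<int d}")
      case True
      then show ?thesis using p u assms(2)
        by (auto simp: G_def tent lo_def hi_def min_def split: if_splits; presburger)
    next
      case False
      then show ?thesis using bounds by auto
    qed
  qed
  \<comment> \<open>For \<open>p = 0\<close> and even \<open>u\<close>, disjointness rests on
    \<open>u < d\<close>: at \<open>u = d\<close> the index of residue \<open>d\<close>, its own
    negative, would lie in both blocks.\<close>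
  also have "card \<dots> = card {lo..<hi} + card {int d - t..<int d}"
    by (rule card_Un_disjoint) (use p u assms(1,2) in \<open>auto simp: lo_def hi_def split: if_splits\<close>)
  also have "\<dots> = u"
    using p u by (auto simp: lo_def hi_def t_def split: if_splits)
  finally have card: "card {i \<in> {0..<int d}. G (2 * i + p)} = u" .
  have "G (a + 2 * int d) = G a" for a
    using tent_add_period[of "int d" a 1] by (simp add: G_def)
  moreover have "G (- a) = G a" for a
    using assms(1) by (simp add: G_def tent_minus)
  ultimately show ?thesis using card that by blast
qed

lemma exists_kernel_subset:
  assumes "M + 1 = d * M'" "N + 1 = d * N'" "u + v = d"
    and p: "p = 0 \<and> (odd u \<or> u < d) \<or> p = 1 \<and> even u"
  shows "\<exists>V. kernel_subset M N (colour_class M N p) V \<and> card V = u * v * M' * N'"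
proof -
  have "d > 0" using assms(1) by (cases d) auto
  moreover have "u \<le> d" using assms(3) by simp
  ultimately obtain G :: "int \<Rightarrow> bool"
    where even: "\<And>a. G (- a) = G a" and per: "\<And>a. G (a + 2 * int d) = G a"
      and u: "card {i \<in> {0..<int d}. G (2 * i + p)} = u"
  proof (rule exists_profile[OF _ _ p])
  qed (assumption | rule that)+
  have "card {i \<in> {0..<int d}. \<not> G (2 * i + p)} = v"
    using card_split[of "{0..<int d}" "\<lambda>i. G (2 * i + p)"] u assms(3) by simp
  then have "card (wave_set M N p G) = u * v * M' * N'"
    using card_wave_set[of G d M M' N N' p] even per assms(1,2) p u by auto
  moreover have "kernel_subset M N (colour_class M N p) (wave_set M N p G)"
  proof (rule kernel_subset_wave_set)
    have *: "G (a + 2 * int d * k) = G a" for a k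
      using per by (rule periodic_int_mult)
    have "int M + 1 = int d * int M'" "int N + 1 = int d * int N'"
      using arg_cong[OF assms(1), of int] arg_cong[OF assms(2), of int] by simp_all
    then show "G (a + 2 * (int M + 1)) = G a" "G (a + 2 * (int N + 1)) = G a" for a
      using *[of a "int M'"] *[of a "int N'"] by (simp_all add: mult.assoc)
  qed (rule even)
  ultimately show ?thesis by blast
qed

lemma kernel_subset_card:
  assumes "M > 0" "N > 0" "d = gcd (M + 1) (N + 1)" "M + 1 = d * M'" "N + 1 = d * N'"
    and p: "p \<in> {0, 1}" and ker: "kernel_subset M N (colour_class M N p) V"
  obtains u v where "u + v = d" "card V = u * v * M' * N'" "p = 1 \<Longrightarrow> even d \<Longrightarrow> even u \<and> even v"
proof -
  obtain G :: "int \<Rightarrow> bool"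
    where even: "\<And>a. G (- a) = G a" and per: "\<And>a. G (a + 2 * int d) = G a"
      and V: "V = wave_set M N p G"
  proof (rule kernel_subset_is_wave_set[OF assms(1,2) ker, folded assms(3)])
  qed (rule that)
  define u where "u = card {i \<in> {0..<int d}. G (2 * i + p)}"
  define v where "v = card {i \<in> {0..<int d}. \<not> G (2 * i + p)}"
  have uv: "u + v = d"
    unfolding u_def v_def by (subst card_split) auto
  have "card V = u * v * M' * N'"
    unfolding V u_def v_def using even per assms(4,5) p by (rule card_wave_set)
  moreover have "even u \<and> even v" if "p = 1" "even d"
  proof -
    have "even u"
      using even_card_odd_profile[of G d] even per that by (auto simp: u_def)
    then show ?thesis using uv \<open>even d\<close> by (metis even_add)
  qed
  ultimately show ?thesis using uv that by blast
qed

theorem theorem3: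
  fixes M N d M' N' :: nat
  assumes "M > 0" and "N > 0"
    and "d = gcd (M + 1) (N + 1)"
    and "M + 1 = d * M'" and "N + 1 = d * N'"
  shows "(\<forall>V. kernel_subset M N (even_vertices M N) V \<or> kernel_subset M N (odd_vertices M N) V \<longrightarrow>
             (\<exists>u v :: nat. u + v = d \<and> card V = u * v * M' * N')) \<and>
         (\<forall>V. kernel_subset M N (odd_vertices M N) V \<and> even d \<longrightarrow>
             (\<exists>u v :: nat. u + v = d \<and> even u \<and> even v \<and> card V = u * v * M' * N')) \<and>
         (\<forall>u v :: nat. u + v = d \<longrightarrow>
             (\<exists>V. kernel_subset M N (even_vertices M N) V \<and> card V = u * v * M' * N')) \<and>
         (\<forall>u v :: nat. u + v = d \<and> (even d \<longrightarrow> even u \<and> even v) \<longrightarrow>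
             (\<exists>V. kernel_subset M N (odd_vertices M N) V \<and> card V = u * v * M' * N'))"
proof (intro conjI allI impI)
  fix V
  assume "kernel_subset M N (even_vertices M N) V \<or> kernel_subset M N (odd_vertices M N) V"
  then obtain p :: int where "p \<in> {0, 1}" "kernel_subset M N (colour_class M N p) V"
    by (metis colour_class_0 colour_class_1 insertCI)
  then show "\<exists>u v. u + v = d \<and> card V = u * v * M' * N'"
    using kernel_subset_card[OF assms] by metis
next
  fix V
  assume "kernel_subset M N (odd_vertices M N) V \<and> even d"
  then show "\<exists>u v. u + v = d \<and> even u \<and> even v \<and> card V = u * v * M' * N'"
    using kernel_subset_card[OF assms, of 1 V] by (metis colour_class_1 insertCI)
next
  fix u v :: nat
  assume uv: "u + v = d"
  have "d > 0" using assms(4) by (cases d) auto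
  \<comment> \<open>The construction excludes only even \<open>u = d\<close>; then
    \<open>v = 0\<close>, and \<open>u\<close> and \<open>v\<close> exchange roles.\<close>
  then consider "odd u \<or> u < d" | "v < d" using uv by linarith
  then show "\<exists>V. kernel_subset M N (even_vertices M N) V \<and> card V = u * v * M' * N'"
  proof cases
    case 1
    then show ?thesis
      using exists_kernel_subset[OF assms(4,5) uv, of 0] by (simp add: colour_class_0)
  next
    case 2
    then show ?thesis
      using exists_kernel_subset[OF assms(4,5), of v u 0] uv
      by (simp add: colour_class_0 add.commute mult.commute mult.left_commute)
  qed
next
  fix u v :: nat
  assume uv: "u + v = d \<and> (even d \<longrightarrow> even u \<and> even v)"
  \<comment> \<open>The construction for odd vertices takes an even number of true residues; for odd
    \<open>d\<close> exactly one of \<open>u\<close> and \<open>v\<close> qualifies.\<close>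
  then consider "even u" | "even v" by fastforce
  then show "\<exists>V. kernel_subset M N (odd_vertices M N) V \<and> card V = u * v * M' * N'"
  proof cases
    case 1
    then show ?thesis
      using exists_kernel_subset[OF assms(4,5), of u v 1] uv by (simp add: colour_class_1)
  next
    case 2
    then show ?thesis
      using exists_kernel_subset[OF assms(4,5), of v u 1] uv
      by (simp add: colour_class_1 add.commute mult.commute mult.left_commute)
  qed
qed

end
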